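(* Let $F$ be bounded below and let $\{x_k\}_{k\in\mathcal S}$ be the accepted iterates of the adaptive prox-convex algorithm described in the context, with ratio threshold $\alpha_1\in(0,1)$ and metrics satisfying $\underline q\,I\preceq Q_k\preceq\overline q\,I$ for all $k$, for constants $0<\underline q\le\overline q<\infty$. Then for every $k\in\mathcal S$, $$F(x_k)-F(x_{k+1})\ \ge\ \frac{\alpha_1}{2}\|x_{k+1}-x_k\|_{Q_k}^2\ \ge\ \frac{\alpha_1\underline q}{2}\|x_{k+1}-x_k\|^2 .$$ Consequently $\sum_{k\in\mathcal S}\|x_{k+1}-x_k\|_{Q_k}^2<\infty$, hence $\|x_{k+1}-x_k\|_{Q_k}\to0$ along $\mathcal S$, and with $\mathcal G_{Q_k}(x_k):=Q_k(x_k-x_{k+1})$, $$\|\mathcal G_{Q_k}(x_k)\|\ \le\ \overline q\,\|x_{k+1}-x_k\|\ \le\ (\overline q/\sqrt{\underline q})\,\|x_{k+1}-x_k\|_{Q_k}\ \to\ 0\quad\text{along }\mathcal S .$$ Moreover, with $\Delta_F:=F(x_0)-\inf F$ and $\mathcal S_N$ the set of the first $N$ accepted indices, $$\frac1N\sum_{k\in\mathcal S_N}\|\mathcal G_{Q_k}(x_k)\|^2\ \le\ \frac{2\,\overline q\,\Delta_F}{\alpha_1N},\qquad \min_{k\in\mathcal S_N}\|\mathcal G_{Q_k}(x_k)\|\ \le\ \sqrt{\frac{2\,\overline q\,\Delta_F}{\alpha_1N}} .$$ Hence $N=O(\varepsilon^{-2})$ accepted steps (with constant depending only on $\overline q,\Delta_F,\alpha_1$)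 suffice to reach $\min_{k\in\mathcal S_N}\|\mathcal G_{Q_k}(x_k)\|\le\varepsilon$.
   Context: **Problem.** $F(x)=g(x)+h(C(x))+s(R(x))$ on $\mathbb R^m$, where $g:\mathbb R^m\to\mathbb R\cup\{+\infty\}$ is proper, closed, convex; $h:\mathbb R^d\to\mathbb R$ is finite-valued, closed, convex; $C:\mathbb R^m\to\mathbb R^d$ and $s:\mathbb R^n\to\mathbb R$ are $\mathcal C^1$; $R=(r_1,\dots,r_n)$ with each $r_i:\mathbb R^m\to\mathbb R$ finite-valued, closed, convex. $\|\cdot\|$ is the Euclidean norm on vectors and the spectral norm on matrices; $\|u\|_Q^2:=u^\top Qu$. **Standing assumptions.** (1) Monotone-or-smooth: for each $\bar x\in\operatorname{dom}F$ there is a neighborhood $W$ of $R(\bar x)$ such that, for every $i$, if $r_i$ is not $\mathcal C^1$ on any neighborhood of $\bar x$ then $\nabla_i s(z)\ge0$ for all $z\in W$. (2) $x_0\in\operatorname{dom}F$ and $\mathcal X_0:=\{x\in\operatorname{dom}F: F(x)\le F(x_0)\}$ is nonempty and compact. (3) $h$ is $L_h$-Lipschitz; $C$ has $\beta_C$-Lipschitz Jacobian; $s$ has $\beta_s$-Lipschitz gradient; each $r_i$ is $L_{r_i}$-Lipschitz. (4) Let $\mathcal I^-$ be the set of indices $i$ with $\nabla_i s(R(x))<0$ for some $x\in\mathcal X_0$. If $\mathcal I^-\ne\emptyset$, then $\|\nabla s(y)\|\le L_s$ for all $y\in\{R(x):F(x)\le F(x_0)\}$, and each $r_i$, $i\in\mathcal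 I^-$, is $\mathcal C^1$ with $\beta_{r_i}$-Lipschitz gradient. **Model.** For $x_k\in\mathcal X_0$, $$F(x;x_k)=g(x)+h\big(C(x_k)+\nabla C(x_k)(x-x_k)\big)+s(R(x_k))+\sum_{i=1}^n\nabla_i s(R(x_k))\,\Phi_i(x;x_k),$$ where $\Phi_i(x;x_k)=r_i(x)-r_i(x_k)$ if $\nabla_i s(R(x_k))\ge0$, and $\Phi_i(x;x_k)=\nabla r_i(x_k)^\top(x-x_k)$ if $\nabla_i s(R(x_k))<0$. $F(\cdot;x_k)$ is convex. The proximal model is $F_{Q}(x;x_k)=F(x;x_k)+\tfrac12\|x-x_k\|_{Q}^2$. **Algorithm.** Input $x_0$, $\mu_0>0$, $\mu_{\min}>0$, $0<\alpha_1<\alpha_2<1$, $\nu_{\rm inc}>1>\nu_{\rm dec}>0$, tolerance $\epsilon_{\rm term}\ge0$. For $k=0,1,2,\dots$: build a symmetric matrix $H_k^+\succeq0$. Repeat: set $Q_k=\mu_kI+H_k^+$; $x_k^+=\arg\min_xF_{Q_k}(x;x_k)$; $\mathrm{Pred}_k=F(x_k)-F_{Q_k}(x_k^+;x_k)$; $\mathrm{Act}_k=F(x_k)-F(x_k^+)$; if $\mathrm{Pred}_k=0$ or $\|Q_k(x_k-x_k^+)\|\le\epsilon_{\rm term}$, terminate and return $x_k$; set $\rho_k=\mathrm{Act}_k/\mathrm{Pred}_k$; if $\rho_k<\alpha_1$ (rejection), set $\mu_k\leftarrow\nu_{\rm inc}\mu_k$; until $\rho_k\ge\alpha_1$ (acceptance).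 Then $x_{k+1}=x_k^+$, and $\mu_{k+1}=\max\{\mu_{\min},\nu_{\rm dec}\mu_k\}$ if $\rho_k>\alpha_2$, $\mu_{k+1}=\mu_k$ otherwise. $\mathcal S\subset\mathbb N$ is the set of accepted indices, i.e. indices $k$ for which a step from $x_k$ to $x_{k+1}$ is accepted; for $k\in\mathcal S$, $Q_k$ is the metric at acceptance. Limits along $\mathcal S$ are meant when $\mathcal S$ is infinite. *)

theory Defs
  imports "HOL-Analysis.Analysis" "HOL-Library.Landau_Symbols"
begin

definition C1_on :: "('a::real_normed_vector \<Rightarrow> 'b::real_normed_vector) \<Rightarrow> 'a set \<Rightarrow> bool"
  where "C1_on f U \<longleftrightarrow>
    (\<exists>f' :: 'a \<Rightarrow> 'a \<Rightarrow>\<^sub>L 'b.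
       (\<forall>x\<in>U. (f has_derivative blinfun_apply (f' x)) (at x)) \<and> continuous_on U f')"

text \<open>Only meaningful where \<open>f\<close> is differentiable; elsewhere the value is unspecified.\<close>

definition grad :: "('a::real_inner \<Rightarrow> real) \<Rightarrow> 'a \<Rightarrow> 'a"
  where "grad f x = (THE D. GDERIV f x :> D)"

definition ereal_epigraph :: "('a \<Rightarrow> ereal) \<Rightarrow> ('a \<times> real) set"
  where "ereal_epigraph f = {(x, t). f x \<le> ereal t}"

definition proper_closed_convex :: "('a::real_normed_vector \<Rightarrow> ereal) \<Rightarrow> bool"
  where "proper_closed_convex f \<longleftrightarrow>
    (\<forall>x. f x \<noteq> -\<infinity>) \<and> (\<exists>x. f x < \<infinity>) \<and> closed (ereal_epigraph f) \<and> convex (ereal_epigraph f)"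

text \<open>\<^const>\<open>norm\<close> on \<^typ>\<open>real^'m^'d\<close> is the Frobenius norm, hence the explicit operator norm.\<close>

definition spectral_norm :: "real^'m^'d \<Rightarrow> real"
  where "spectral_norm A = onorm (\<lambda>v. A *v v)"

definition psd :: "real^'m^'m \<Rightarrow> bool"
  where "psd A \<longleftrightarrow> transpose A = A \<and> (\<forall>v. 0 \<le> v \<bullet> (A *v v))"

definition loewner_le :: "real^'m^'m \<Rightarrow> real^'m^'m \<Rightarrow> bool"  (infix \<open>\<preceq>\<close> 50)
  where "A \<preceq> B \<longleftrightarrow> psd (B - A)"

definition sqnorm_Q :: "real^'m^'m \<Rightarrow> real^'m \<Rightarrow> real"
  where "sqnorm_Q Q u = u \<bullet> (Q *v u)"

definition norm_Q :: "real^'m^'m \<Rightarrow> real^'m \<Rightarrow> real"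
  where "norm_Q Q u = sqrt (sqnorm_Q Q u)"

locale prox_convex_data =
  fixes g :: "real^'m \<Rightarrow> ereal"
    and h :: "real^'d \<Rightarrow> real"
    and C :: "real^'m \<Rightarrow> real^'d"
    and s :: "real^'n \<Rightarrow> real"
    and r :: "'n \<Rightarrow> real^'m \<Rightarrow> real"
begin

definition R :: "real^'m \<Rightarrow> real^'n"
  where "R x = (\<chi> i. r i x)"

definition F :: "real^'m \<Rightarrow> ereal"
  where "F x = g x + ereal (h (C x)) + ereal (s (R x))"

definition dom_F :: "(real^'m) set"
  where "dom_F = {x. F x < \<infinity>}"

definition sublevel :: "real^'m \<Rightarrow> (real^'m) set"
  where "sublevel x0 = {x \<in> dom_F. F x \<le> F x0}"

definition neg_indices :: "real^'m \<Rightarrow> 'n set"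
  where "neg_indices x0 = {i. \<exists>x \<in> sublevel x0. grad s (R x) $ i < 0}"

definition \<Phi> :: "'n \<Rightarrow> real^'m \<Rightarrow> real^'m \<Rightarrow> real"
  where "\<Phi> i xk x =
    (if grad s (R xk) $ i \<ge> 0 then r i x - r i xk else grad (r i) xk \<bullet> (x - xk))"

definition model :: "real^'m \<Rightarrow> real^'m \<Rightarrow> ereal"
  where "model xk x =
    g x + ereal (h (C xk + jacobian C (at xk) *v (x - xk))) + ereal (s (R xk))
      + ereal (\<Sum>i\<in>UNIV. grad s (R xk) $ i * \<Phi> i xk x)"

definition prox_model :: "real^'m^'m \<Rightarrow> real^'m \<Rightarrow> real^'m \<Rightarrow> ereal"
  where "prox_model Q xk x = model xk x + ereal (1/2 * sqnorm_Q Q (x - xk))"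

definition prox_step :: "real^'m^'m \<Rightarrow> real^'m \<Rightarrow> real^'m \<Rightarrow> bool"
  where "prox_step Q xk xp \<longleftrightarrow> is_arg_min (prox_model Q xk) (\<lambda>_. True) xp"

text \<open>
  In \<^typ>\<open>ereal\<close>, \<open>\<infinity> - \<infinity> = \<infinity>\<close>. This case does not occur along a run: \<open>F xk\<close> is finite on
  \<open>dom_F\<close>, and a minimizer of the prox model has finite model value, hence finite \<open>g\<close> and \<open>F\<close>.
\<close>

definition Pred :: "real^'m^'m \<Rightarrow> real^'m \<Rightarrow> real^'m \<Rightarrow> ereal"
  where "Pred Q xk xp = F xk - prox_model Q xk xp"

definition Act :: "real^'m \<Rightarrow> real^'m \<Rightarrow> ereal"
  where "Act xk xp = F xk - F xp"

definition \<rho> :: "real^'m^'m \<Rightarrow> real^'m \<Rightarrow> real^'m \<Rightarrow> ereal"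
  where "\<rho> Q xk xp = Act xk xp / Pred Q xk xp"

definition stops :: "real \<Rightarrow> real^'m^'m \<Rightarrow> real^'m \<Rightarrow> real^'m \<Rightarrow> bool"
  where "stops eps Q xk xp \<longleftrightarrow> Pred Q xk xp = 0 \<or> norm (Q *v (xk - xp)) \<le> eps"

definition rejected_trial ::
    "real \<Rightarrow> real \<Rightarrow> real^'m^'m \<Rightarrow> real^'m \<Rightarrow> real^'m \<Rightarrow> bool"
  where "rejected_trial eps \<alpha>1 Q xk xp \<longleftrightarrow>
    prox_step Q xk xp \<and> \<not> stops eps Q xk xp \<and> \<rho> Q xk xp < ereal \<alpha>1"

definition accepted_trial ::
    "real \<Rightarrow> real \<Rightarrow> real^'m^'m \<Rightarrow> real^'m \<Rightarrow> real^'m \<Rightarrow> bool"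
  where "accepted_trial eps \<alpha>1 Q xk xp \<longleftrightarrow>
    prox_step Q xk xp \<and> \<not> stops eps Q xk xp \<and> \<rho> Q xk xp \<ge> ereal \<alpha>1"

text \<open>
  \<open>reaches eps \<alpha>1 \<nu>inc Hk xk \<mu> \<mu>'\<close>: the repeat-loop at \<open>xk\<close>, entered with parameter \<open>\<mu>\<close>,
  performs a trial with parameter \<open>\<mu>'\<close>, all earlier trials having been rejected.
\<close>

inductive reaches ::
    "real \<Rightarrow> real \<Rightarrow> real \<Rightarrow> real^'m^'m \<Rightarrow> real^'m \<Rightarrow> real \<Rightarrow> real \<Rightarrow> bool"
  for eps \<alpha>1 \<nu>inc :: real and Hk :: "real^'m^'m" and xk :: "real^'m" and \<mu> :: real
  where
    enter: "reaches eps \<alpha>1 \<nu>inc Hk xk \<mu> \<mu>"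
  | reject: "reaches eps \<alpha>1 \<nu>inc Hk xk \<mu> \<mu>' \<Longrightarrow> rejected_trial eps \<alpha>1 (mat \<mu>' + Hk) xk xp
      \<Longrightarrow> reaches eps \<alpha>1 \<nu>inc Hk xk \<mu> (\<nu>inc * \<mu>')"

end

locale prox_convex_problem = prox_convex_data g h C s r
  for g :: "real^'m \<Rightarrow> ereal"
    and h :: "real^'d \<Rightarrow> real"
    and C :: "real^'m \<Rightarrow> real^'d"
    and s :: "real^'n \<Rightarrow> real"
    and r :: "'n \<Rightarrow> real^'m \<Rightarrow> real" +
  fixes x0 :: "real^'m"
    and L_h \<beta>_C \<beta>_s L_s :: real
    and L_r \<beta>_r :: "'n \<Rightarrow> real"
  assumes g_pcc: "proper_closed_convex g"
    and h_convex: "convex_on UNIV h"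
    and h_closed: "closed (epigraph UNIV h)"
    and C_C1: "C1_on C UNIV"
    and s_C1: "C1_on s UNIV"
    and r_convex: "\<And>i. convex_on UNIV (r i)"
    and r_closed: "\<And>i. closed (epigraph UNIV (r i))"
    and monotone_or_smooth:
      "\<And>y. y \<in> dom_F \<Longrightarrow>
         \<exists>W. open W \<and> R y \<in> W \<and>
           (\<forall>i. \<not> (\<exists>U. open U \<and> y \<in> U \<and> C1_on (r i) U) \<longrightarrow> (\<forall>z\<in>W. grad s z $ i \<ge> 0))"
    and x0_dom: "x0 \<in> dom_F"
    and sublevel_nonempty: "sublevel x0 \<noteq> {}"
    and sublevel_compact: "compact (sublevel x0)"
    and h_lipschitz: "L_h-lipschitz_on UNIV h"
    and C_lipschitz_jacobian:
      "0 \<le> \<beta>_C"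
      "\<And>x y. spectral_norm (jacobian C (at x) - jacobian C (at y)) \<le> \<beta>_C * norm (x - y)"
    and s_lipschitz_grad: "\<beta>_s-lipschitz_on UNIV (grad s)"
    and r_lipschitz: "\<And>i. (L_r i)-lipschitz_on UNIV (r i)"
    and neg_grad_bound:
      "\<And>x. neg_indices x0 \<noteq> {} \<Longrightarrow> F x \<le> F x0 \<Longrightarrow> norm (grad s (R x)) \<le> L_s"
    and neg_smooth:
      "\<And>i. i \<in> neg_indices x0 \<Longrightarrow> C1_on (r i) UNIV"
      "\<And>i. i \<in> neg_indices x0 \<Longrightarrow> (\<beta>_r i)-lipschitz_on UNIV (grad (r i))"

text \<open>
  \<open>\<mu> k\<close> is the value of the regularisation parameter when iteration \<open>k\<close> is entered and \<open>\<mu>acc k\<close>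
  its value at acceptance. Iteration \<open>k\<close> is entered iff all earlier ones accepted a step, i.e.
  \<open>{..<k} \<subseteq> S\<close>. An entered iteration outside \<open>S\<close> is one in which the algorithm terminates
  or rejects forever; the sequences are unconstrained after it. Nothing is required of \<open>H k\<close> besides
  being symmetric positive semidefinite, so it may depend on the whole history.
\<close>

locale prox_convex_run = prox_convex_problem g h C s r x0 L_h \<beta>_C \<beta>_s L_s L_r \<beta>_r
  for g :: "real^'m \<Rightarrow> ereal"
    and h :: "real^'d \<Rightarrow> real"
    and C :: "real^'m \<Rightarrow> real^'d"
    and s :: "real^'n \<Rightarrow> real"
    and r :: "'n \<Rightarrow> real^'m \<Rightarrow> real"
    and x0 :: "real^'m"
    and L_h \<beta>_C \<beta>_s L_s :: real
    and L_r \<beta>_r :: "'n \<Rightarrow> real" +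
  fixes \<mu>0 \<mu>min \<alpha>1 \<alpha>2 \<nu>inc \<nu>dec eps_term :: real
    and H :: "nat \<Rightarrow> real^'m^'m"
    and x :: "nat \<Rightarrow> real^'m"
    and \<mu> \<mu>acc :: "nat \<Rightarrow> real"
    and Q :: "nat \<Rightarrow> real^'m^'m"
    and S :: "nat set"
  assumes params:
      "\<mu>0 > 0" "\<mu>min > 0" "0 < \<alpha>1" "\<alpha>1 < \<alpha>2" "\<alpha>2 < 1"
      "\<nu>inc > 1" "1 > \<nu>dec" "\<nu>dec > 0" "eps_term \<ge> 0"
    and x_init: "x 0 = x0"
    and \<mu>_init: "\<mu> 0 = \<mu>0"
    and H_psd: "\<And>k. {..<k} \<subseteq> S \<Longrightarrow> psd (H k)"
    and accepted_indices:
      "\<And>k. k \<in> S \<longleftrightarrow> {..<k} \<subseteq> S \<and>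
         (\<exists>\<mu>' xp. reaches eps_term \<alpha>1 \<nu>inc (H k) (x k) (\<mu> k) \<mu>' \<and>
                  accepted_trial eps_term \<alpha>1 (mat \<mu>' + H k) (x k) xp)"
    and at_acceptance:
      "\<And>k. k \<in> S \<Longrightarrow> reaches eps_term \<alpha>1 \<nu>inc (H k) (x k) (\<mu> k) (\<mu>acc k)"
      "\<And>k. k \<in> S \<Longrightarrow> Q k = mat (\<mu>acc k) + H k"
      "\<And>k. k \<in> S \<Longrightarrow> accepted_trial eps_term \<alpha>1 (Q k) (x k) (x (Suc k))"
    and \<mu>_update:
      "\<And>k. k \<in> S \<Longrightarrow> \<mu> (Suc k) =
         (if \<rho> (Q k) (x k) (x (Suc k)) > ereal \<alpha>2 then max \<mu>min (\<nu>dec * \<mu>acc k) else \<mu>acc k)"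

text \<open>For finite \<open>S\<close> this is the trivial filter, so limits along \<open>S\<close> say something only for infinite \<open>S\<close>.\<close>

definition along :: "nat set \<Rightarrow> nat filter"
  where "along S = inf sequentially (principal S)"

definition at_least_accepted :: "nat \<Rightarrow> nat set \<Rightarrow> bool"
  where "at_least_accepted N S \<longleftrightarrow> infinite S \<or> N \<le> card S"

definition first_accepted :: "nat \<Rightarrow> nat set \<Rightarrow> nat set"
  where "first_accepted N S = {k \<in> S. card {j \<in> S. j < k} < N}"

text \<open>The least \<open>N \<ge> 1\<close> with \<open>sqrt (2 * qhi * \<Delta> / (\<alpha>1 * N)) \<le> \<epsilon>\<close>. 
  The maximum with \<open>1\<close> only matters when \<open>\<Delta> = 0\<close>: a minimum over accepted steps needs one.\<close>

definition step_bound :: "real \<Rightarrow> real \<Rightarrow> real \<Rightarrow> real \<Rightarrow> nat"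
  where "step_bound qhi \<Delta> \<alpha>1 \<epsilon> = max 1 (nat \<lceil>2 * qhi * \<Delta> / (\<alpha>1 * \<epsilon>\<^sup>2)\<rceil>)"

end

theory Submission
  imports Defs
begin

text \<open>
  Every accepted step pays for its own length. The model is convex: \<open>C\<close> is linearized inside
  the convex function \<open>h\<close>, and each \<open>r\<^sub>i\<close> with a negative weight is linearized too. Hence the
  proximal model grows quadratically around its minimizer \<open>x\<^sub>k\<^sup>+\<close>, and as its value at \<open>x\<^sub>k\<close> is
  \<open>F(x\<^sub>k)\<close>, the predicted decrease is at least half the squared \<open>Q\<^sub>k\<close>-norm of the step
  (\<open>Pred_ge_half_sqnorm_Q\<close>). The ratio test turns this into an actual decrease of at least
  \<open>\<alpha>\<^sub>1 / 2\<close> times the squared \<open>Q\<^sub>k\<close>-norm (\<open>accepted_trial_decrease\<close>).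

  These decreases telescope, and their sum cannot exceed \<open>\<Delta>\<^sub>F\<close>; this gives summability and all
  the limits. For the rates, \<open>Q\<^sub>k\<^sup>2 \<preceq> q Q\<^sub>k\<close> with \<open>q\<close> the upper metric bound, so that the squared norm
  of the gradient mapping is at most \<open>q\<close> times the squared \<open>Q\<^sub>k\<close>-norm of the step
  (\<open>norm_matrix_vector_sq_le_sqnorm_Q\<close>); averaging over the first \<open>N\<close> accepted steps, which are
  just the steps \<open>0, \<dots>, N - 1\<close>, gives the bound on the mean, and the square of the minimum is
  at most that mean.

  The extended-real arithmetic is harmless: a minimizer of the proximal model at a point of
  the domain has finite model value, so all iterates stay in the domain of \<open>F\<close>.
\<close>

section \<open>Quadratic forms and Loewner bounds\<close>

lemma mat_matrix_vector_mult: "mat c *v v = c *\<^sub>R v"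
  for v :: "real^'m"
proof -
  have "mat c = c *\<^sub>R (mat 1 :: real^'m^'m)"
    by (simp add: mat_def vec_eq_iff)
  then show ?thesis
    by (simp flip: scaleR_matrix_vector_assoc)
qed

lemma sqnorm_Q_scaleR: "sqnorm_Q Q (t *\<^sub>R v) = t\<^sup>2 * sqnorm_Q Q v"
  by (simp add: sqnorm_Q_def matrix_vector_mult_scaleR power2_eq_square)

lemma sqnorm_Q_minus_commute: "sqnorm_Q Q (u - v) = sqnorm_Q Q (v - u)"
  using sqnorm_Q_scaleR[of Q "-1" "v - u"] by simp

lemma psd_inner_commute:
  assumes "psd A"
  shows "u \<bullet> (A *v v) = v \<bullet> (A *v u)"
proof -
  have "transpose A = A"
    using assms by (simp add: psd_def)
  then show ?thesis
    by (metis dot_lmul_matrix inner_commute transpose_matrix_vector)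
qed

text \<open>The quadratic \<open>t \<mapsto> sqnorm_Q A (u + t *\<^sub>R v)\<close> is nonnegative, so its discriminant is not
  positive.\<close>

lemma psd_Cauchy_Schwarz:
  assumes "psd A"
  shows "(u \<bullet> (A *v v))\<^sup>2 \<le> sqnorm_Q A u * sqnorm_Q A v"
proof -
  have nonneg: "0 \<le> sqnorm_Q A w" for w
    using assms by (simp add: psd_def sqnorm_Q_def)
  have expand: "sqnorm_Q A (u + t *\<^sub>R v) =
      sqnorm_Q A u + 2 * t * (u \<bullet> (A *v v)) + t\<^sup>2 * sqnorm_Q A v" for t
    using psd_inner_commute[OF assms, of v u]
    by (simp add: sqnorm_Q_def matrix_vector_right_distrib matrix_vector_mult_scaleR
        inner_add_left inner_add_right power2_eq_square algebra_simps)
  let ?a = "sqnorm_Q A v" and ?b = "u \<bullet> (A *v v)" and ?c = "sqnorm_Q A u"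
  have quad: "0 \<le> ?c + 2 * t * ?b + t\<^sup>2 * ?a" for t
    using nonneg[of "u + t *\<^sub>R v"] unfolding expand .
  show ?thesis
  proof (cases "?a = 0")
    case True
    have "?b = 0"
    proof (rule ccontr)
      assume "?b \<noteq> 0"
      \<comment> \<open>This \<open>t\<close> makes the now affine function of \<open>t\<close> equal to \<open>-1\<close>.\<close>
      then show False
        using quad[of "- (?c + 1) / (2 * ?b)"] True by (simp add: field_simps)
    qed
    then show ?thesis
      using True by simp
  next
    case False
    with nonneg[of v] have "?a > 0"
      by simp
    \<comment> \<open>The minimizer of the quadratic.\<close>
    then show ?thesis
      using quad[of "- ?b / ?a"] by (simp add: field_simps power2_eq_square)
  qed
qed

lemma loewner_le_sqnorm_Q:
  assumes "A \<preceq> B"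
  shows "sqnorm_Q A v \<le> sqnorm_Q B v"
  using assms
  by (simp add: loewner_le_def psd_def sqnorm_Q_def matrix_vector_mult_diff_rdistrib
      inner_diff_right)

lemma sqnorm_Q_mat: "sqnorm_Q (mat c) v = c * (norm v)\<^sup>2"
  by (simp add: sqnorm_Q_def mat_matrix_vector_mult power2_norm_eq_inner)

lemma psd_of_loewner_ge_mat:
  assumes "0 \<le> c" and "mat c \<preceq> A"
  shows "psd A"
proof -
  have "transpose (A - mat c) = A - mat c"
    using assms(2) by (simp add: loewner_le_def psd_def)
  then have entries: "transpose (A - mat c) $ i $ j = (A - mat c) $ i $ j" for i j
    by simp
  have "transpose A $ i $ j = A $ i $ j" for i j
    using entries[of i j] by (auto simp: transpose_def mat_def split: if_splits)
  then have "transpose A = A"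
    by (simp add: vec_eq_iff)
  moreover have "0 \<le> sqnorm_Q A v" for v
    using loewner_le_sqnorm_Q[OF assms(2), of v] mult_nonneg_nonneg[OF assms(1), of "(norm v)\<^sup>2"]
    by (simp add: sqnorm_Q_mat)
  ultimately show ?thesis
    by (simp add: psd_def sqnorm_Q_def)
qed

text \<open>This is \<open>Q\<^sup>2 \<preceq> c Q\<close> in terms of vectors. It bounds the gradient mapping by the \<open>Q\<close>-norm of
  the step at the cost of a single factor \<open>c\<close>; going through the Euclidean norm of the step would
  bring in the condition number of \<open>Q\<close>. It follows from the Cauchy-Schwarz inequality with
  \<open>u = Q v\<close>, after a factor \<open>(norm (Q *v v))\<^sup>2\<close> is cancelled.\<close>

lemma norm_matrix_vector_sq_le_sqnorm_Q:
  assumes "psd Q" and "Q \<preceq> mat c"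
  shows "(norm (Q *v v))\<^sup>2 \<le> c * sqnorm_Q Q v"
proof (cases "Q *v v = 0")
  case True
  then show ?thesis
    by (simp add: sqnorm_Q_def)
next
  case False
  let ?n = "(norm (Q *v v))\<^sup>2"
  have n_pos: "?n > 0"
    using False by simp
  have nonneg: "0 \<le> sqnorm_Q Q v"
    using assms(1) by (simp add: psd_def sqnorm_Q_def)
  have "?n * ?n = ((Q *v v) \<bullet> (Q *v v))\<^sup>2"
    unfolding power2_norm_eq_inner by (simp add: power2_eq_square)
  also have "\<dots> \<le> sqnorm_Q Q (Q *v v) * sqnorm_Q Q v"
    by (rule psd_Cauchy_Schwarz[OF assms(1)])
  also have "\<dots> \<le> (c * ?n) * sqnorm_Q Q v"
    using loewner_le_sqnorm_Q[OF assms(2), of "Q *v v"] nonneg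
    by (intro mult_right_mono) (simp_all add: sqnorm_Q_mat)
  finally have "?n * ?n \<le> ?n * (c * sqnorm_Q Q v)"
    by (simp add: algebra_simps)
  then show ?thesis
    using n_pos by (rule mult_left_le_imp_le)
qed

section \<open>Predicted decrease of a proximal step\<close>

context prox_convex_data
begin

definition finite_model :: "real^'m \<Rightarrow> real^'m \<Rightarrow> real"
  where "finite_model xk y = h (C xk + jacobian C (at xk) *v (y - xk)) + s (R xk)
    + (\<Sum>i\<in>UNIV. grad s (R xk) $ i * \<Phi> i xk y)"

lemma model_eq_finite_model: "model xk y = g y + ereal (finite_model xk y)"
  by (simp add: model_def finite_model_def add.assoc)

lemma finite_model_center: "finite_model xk xk = h (C xk) + s (R xk)"
proof -
  have "\<Phi> i xk xk = 0" for i
    by (simp add: \<Phi>_def)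
  then show ?thesis
    by (simp add: finite_model_def)
qed

lemma model_center: "model xk xk = F xk"
  by (simp add: model_eq_finite_model finite_model_center F_def add.assoc)

end

lemma convex_on_sum_functions:
  assumes "convex S" and "\<And>i. i \<in> A \<Longrightarrow> convex_on S (f i)"
  shows "convex_on S (\<lambda>x. \<Sum>i\<in>A. f i x)"
  using assms by (induction A rule: infinite_finite_induct) (auto simp: convex_on_const)

context prox_convex_problem
begin

text \<open>The case distinction in \<open>\<Phi>\<close> is made for this: the convex function \<open>r i\<close> is kept only when its
  weight is nonnegative, and is replaced by an affine function otherwise.\<close>

lemma convex_weighted_\<Phi>: "convex_on UNIV (\<lambda>y. grad s (R xk) $ i * \<Phi> i xk y)"
proof (cases "grad s (R xk) $ i \<ge> 0")
  case True
  have "convex_on UNIV (\<lambda>y. r i y + (- r i xk))"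
    by (intro convex_on_add r_convex) (simp add: convex_on_const)
  then show ?thesis
    using True convex_on_cmul[OF True] by (simp add: \<Phi>_def)
next
  case False
  then show ?thesis
    by (auto simp: \<Phi>_def convex_on_def inner_diff_right inner_add_right algebra_simps
        simp flip: distrib_right)
qed

lemma convex_linearized_h:
  "convex_on UNIV (\<lambda>y. h (C xk + jacobian C (at xk) *v (y - xk)))"
proof (rule convex_onI)
  fix t :: real and y z :: "real^'m"
  assume t: "0 < t" "t < 1"
  let ?l = "\<lambda>y. C xk + jacobian C (at xk) *v (y - xk)"
  have "?l ((1 - t) *\<^sub>R y + t *\<^sub>R z) = (1 - t) *\<^sub>R ?l y + t *\<^sub>R ?l z"
    by (simp add: matrix_vector_right_distrib matrix_vector_mult_diff_distrib
        matrix_vector_mult_scaleR algebra_simps)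
  then show "h (?l ((1 - t) *\<^sub>R y + t *\<^sub>R z)) \<le> (1 - t) * h (?l y) + t * h (?l z)"
    using convex_onD[OF h_convex, of t "?l y" "?l z"] t by simp
qed simp

lemma convex_finite_model: "convex_on UNIV (finite_model xk)"
proof -
  have "convex_on UNIV (\<lambda>y. \<Sum>i\<in>UNIV. grad s (R xk) $ i * \<Phi> i xk y)"
    by (intro convex_on_sum_functions convex_weighted_\<Phi>) simp
  moreover have "convex_on UNIV (\<lambda>_::real^'m. s (R xk))"
    by (simp add: convex_on_const)
  ultimately show ?thesis
    unfolding finite_model_def[abs_def] by (intro convex_on_add convex_linearized_h)
qed

lemma g_not_MInf: "g y \<noteq> - \<infinity>"
  using g_pcc by (simp add: proper_closed_convex_def)

lemma g_convex:
  assumes "g y = ereal a" and "g z = ereal b" and "0 \<le> t" and "t \<le> 1"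
  shows "g ((1 - t) *\<^sub>R y + t *\<^sub>R z) \<le> ereal ((1 - t) * a + t * b)"
proof -
  have "convex (ereal_epigraph g)"
    using g_pcc by (simp add: proper_closed_convex_def)
  moreover have "(y, a) \<in> ereal_epigraph g" "(z, b) \<in> ereal_epigraph g"
    using assms by (simp_all add: ereal_epigraph_def)
  ultimately have "(1 - t) *\<^sub>R (y, a) + t *\<^sub>R (z, b) \<in> ereal_epigraph g"
    using assms(3,4) by (intro convexD) auto
  then show ?thesis
    by (simp add: ereal_epigraph_def)
qed

lemma F_finite_iff: "(\<exists>a. F y = ereal a) \<longleftrightarrow> (\<exists>a. g y = ereal a)"
  using g_not_MInf[of y] by (cases "g y") (simp_all add: F_def)

lemma dom_F_iff: "y \<in> dom_F \<longleftrightarrow> (\<exists>a. F y = ereal a)"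
  using g_not_MInf[of y] by (cases "g y") (simp_all add: F_def dom_F_def)

lemma prox_step_in_dom_F:
  assumes "xk \<in> dom_F" and "prox_step Q xk xp"
  shows "xp \<in> dom_F"
proof -
  have "prox_model Q xk xp \<le> prox_model Q xk xk"
    using assms(2) by (auto simp: prox_step_def is_arg_min_linorder)
  also have "\<dots> = F xk"
    by (simp add: prox_model_def model_center sqnorm_Q_def zero_ereal_def[symmetric])
  also have "\<dots> < \<infinity>"
    using assms(1) by (simp add: dom_F_def)
  finally have "g xp \<noteq> \<infinity>"
    by (auto simp: prox_model_def model_eq_finite_model)
  then show ?thesis
    using g_not_MInf[of xp] unfolding dom_F_iff F_finite_iff by (cases "g xp") auto
qed

text \<open>Comparing the minimizer with \<open>xk\<close> itself only shows that the predicted decrease is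
  nonnegative. Comparing it with the points \<open>xp + t *\<^sub>R (xk - xp)\<close> uses the convexity of the model and
  recovers, in the limit \<open>t \<rightarrow> 0\<close>, the quadratic growth of the proximal model around its
  minimizer.\<close>

lemma Pred_ge_half_sqnorm_Q:
  assumes "xk \<in> dom_F" and step: "prox_step Q xk xp"
  obtains p where "Pred Q xk xp = ereal p" and "1/2 * sqnorm_Q Q (xp - xk) \<le> p"
proof -
  obtain a where a: "g xk = ereal a"
    using assms(1) dom_F_iff F_finite_iff by blast
  obtain b where b: "g xp = ereal b"
    using prox_step_in_dom_F[OF assms] dom_F_iff F_finite_iff by blast
  define q where "q = sqnorm_Q Q (xp - xk)"
  define mk where "mk = a + finite_model xk xk"
  define mp where "mp = b + finite_model xk xp"
  have bound: "mp - mk + q \<le> t * (q / 2)" if t: "0 < t" "t < 1" for t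
  proof -
    define y where "y = (1 - t) *\<^sub>R xp + t *\<^sub>R xk"
    have "y - xk = (1 - t) *\<^sub>R (xp - xk)"
      by (simp add: y_def algebra_simps)
    then have dist_y: "sqnorm_Q Q (y - xk) = (1 - t)\<^sup>2 * q"
      by (simp add: sqnorm_Q_scaleR q_def)
    have gy: "g y \<le> ereal ((1 - t) * b + t * a)"
      unfolding y_def using t by (intro g_convex a b) auto
    have my: "finite_model xk y \<le> (1 - t) * finite_model xk xp + t * finite_model xk xk"
      unfolding y_def using t by (intro convex_onD[OF convex_finite_model]) auto
    have "prox_model Q xk xp \<le> prox_model Q xk y"
      using step by (auto simp: prox_step_def is_arg_min_linorder)
    also have "\<dots> \<le> ereal ((1 - t) * b + t * a) + ereal (finite_model xk y)
        + ereal (1/2 * ((1 - t)\<^sup>2 * q))"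
      unfolding prox_model_def model_eq_finite_model dist_y
      by (intro add_right_mono gy)
    finally have "mp + 1/2 * q \<le> (1 - t) * b + t * a + finite_model xk y + 1/2 * ((1 - t)\<^sup>2 * q)"
      by (simp add: prox_model_def model_eq_finite_model b mp_def q_def)
    also have "\<dots> \<le> (1 - t) * mp + t * mk + 1/2 * ((1 - t)\<^sup>2 * q)"
      using my by (simp add: mp_def mk_def algebra_simps)
    finally have "t * (mp - mk + q) \<le> t * (t * (q / 2))"
      by (simp add: algebra_simps power2_eq_square)
    then show ?thesis
      using t by simp
  qed
  have "mp - mk + q \<le> 0"
  proof (rule tendsto_le[of "at_right (0::real)"])
    show "((\<lambda>t. t * (q / 2)) \<longlongrightarrow> 0) (at_right 0)"
      by (auto intro!: tendsto_eq_intros)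
    show "((\<lambda>_. mp - mk + q) \<longlongrightarrow> mp - mk + q) (at_right (0::real))"
      by simp
    show "\<forall>\<^sub>F t in at_right 0. mp - mk + q \<le> t * (q / 2)"
      using eventually_at_right[of "0::real" 1] bound by (auto intro!: exI[of _ 1])
  qed simp
  then have "1/2 * q \<le> mk - (mp + 1/2 * q)"
    by simp
  moreover have "Pred Q xk xp = ereal (mk - (mp + 1/2 * q))"
    by (simp add: Pred_def prox_model_def model_eq_finite_model b a mp_def mk_def q_def
        flip: model_center)
  ultimately show thesis
    using that unfolding q_def by blast
qed

text \<open>The acceptance test compares the actual with the predicted decrease. Since the stopping test
  excludes a predicted decrease of zero, the quotient \<open>\<rho>\<close> can be cleared of its denominator as
  soon as that decrease is known to be nonnegative.\<close>

lemma accepted_trial_decrease: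
  assumes "xk \<in> dom_F" and acc: "accepted_trial eps \<alpha> Q xk xp" and "0 \<le> \<alpha>"
    and "0 \<le> sqnorm_Q Q (xp - xk)"
  shows "F xk - F xp \<ge> ereal (\<alpha> / 2 * sqnorm_Q Q (xp - xk))"
proof -
  have step: "prox_step Q xk xp" and "Pred Q xk xp \<noteq> 0" and ratio: "\<rho> Q xk xp \<ge> ereal \<alpha>"
    using acc by (simp_all add: accepted_trial_def stops_def)
  obtain p where p: "Pred Q xk xp = ereal p" and p_ge: "1/2 * sqnorm_Q Q (xp - xk) \<le> p"
    using Pred_ge_half_sqnorm_Q[OF assms(1) step] .
  have "p > 0"
    using p p_ge assms(4) \<open>Pred Q xk xp \<noteq> 0\<close> by (cases "p = 0") (auto simp: zero_ereal_def)
  obtain a b where "F xk = ereal a" and "F xp = ereal b"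
    using assms(1) prox_step_in_dom_F[OF assms(1) step] dom_F_iff by blast
  moreover from this have "\<alpha> * p \<le> a - b"
    using ratio p \<open>p > 0\<close> by (simp add: \<rho>_def Act_def field_simps)
  moreover have "\<alpha> / 2 * sqnorm_Q Q (xp - xk) \<le> \<alpha> * p"
    using mult_left_mono[OF p_ge assms(3)] by simp
  ultimately show ?thesis
    by simp
qed

end

section \<open>Sums along the accepted indices\<close>

lemma summable_on_tendsto_along:
  fixes f :: "nat \<Rightarrow> real"
  assumes "f summable_on S"
  shows "(f \<longlongrightarrow> 0) (along S)"
proof -
  have "(\<lambda>k. if k \<in> S then f k else 0) summable_on UNIV"
    using assms by (subst (asm) summable_on_cong_neutral[where g = "\<lambda>k. if k \<in> S then f k else 0"
        and T = UNIV]) auto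
  then have "(\<lambda>k. if k \<in> S then f k else 0) \<longlonglongrightarrow> 0"
    by (intro summable_LIMSEQ_zero summable_on_imp_summable)
  then have "((\<lambda>k. if k \<in> S then f k else 0) \<longlongrightarrow> 0) (along S)"
    unfolding along_def by (rule tendsto_mono[OF inf_le1])
  then show ?thesis
    by (rule Lim_transform_eventually) (simp add: along_def eventually_inf_principal)
qed

text \<open>An iteration without an accepted step ends the run, so the accepted indices form an initial
  segment of the naturals. The sums over accepted indices are therefore ordinary sums over
  consecutive steps, and these telescope.\<close>

lemma first_accepted_eq_lessThan:
  assumes closed: "\<And>k. k \<in> S \<Longrightarrow> {..<k} \<subseteq> S" and "at_least_accepted N S"
  shows "{..<N} \<subseteq> S" and "first_accepted N S = {..<N}"
proof -
  show sub: "{..<N} \<subseteq> S"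
  proof (rule ccontr)
    assume "\<not> {..<N} \<subseteq> S"
    then obtain k where k: "k < N" "k \<notin> S"
      by auto
    have "S \<subseteq> {..<k}"
    proof
      fix j
      assume "j \<in> S"
      then show "j \<in> {..<k}"
        using closed[of j] k(2) by (cases j k rule: linorder_cases) auto
    qed
    then have "finite S" "card S \<le> k"
      using finite_subset card_mono[of "{..<k}" S] by auto
    then show False
      using assms(2) k(1) by (simp add: at_least_accepted_def)
  qed
  have "card {j \<in> S. j < k} = k" if "k \<in> S" for k
  proof -
    have "{j \<in> S. j < k} = {..<k}"
      using closed[OF that] by auto
    then show ?thesis
      by simp
  qed
  then show "first_accepted N S = {..<N}"
    using sub by (auto simp: first_accepted_def)
qed

lemma Min_le_sqrt_mean_square:
  fixes f :: "'a \<Rightarrow> real"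
  assumes "finite A" and "A \<noteq> {}" and "\<And>k. k \<in> A \<Longrightarrow> 0 \<le> f k"
    and "1 / real (card A) * (\<Sum>k\<in>A. (f k)\<^sup>2) \<le> c"
  shows "Min (f ` A) \<le> sqrt c"
proof -
  let ?m = "Min (f ` A)"
  have "?m \<in> f ` A"
    using assms(1,2) by (intro Min_in) auto
  then have "0 \<le> ?m"
    using assms(3) by auto
  have "real (card A) * ?m\<^sup>2 = (\<Sum>k\<in>A. ?m\<^sup>2)"
    by simp
  also have "\<dots> \<le> (\<Sum>k\<in>A. (f k)\<^sup>2)"
    using assms(1) \<open>0 \<le> ?m\<close> by (intro sum_mono power_mono Min_le) auto
  finally have "?m\<^sup>2 \<le> 1 / real (card A) * (\<Sum>k\<in>A. (f k)\<^sup>2)"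
    using assms(1,2) by (simp add: field_simps card_gt_0_iff)
  then have "?m\<^sup>2 \<le> c"
    using assms(4) by linarith
  then show ?thesis
    by (rule real_le_rsqrt)
qed

lemma step_bound_sufficient:
  assumes "0 < \<alpha>1" and "0 < \<epsilon>" and "step_bound qhi \<Delta> \<alpha>1 \<epsilon> \<le> N"
  shows "1 \<le> N" and "sqrt (2 * qhi * \<Delta> / (\<alpha>1 * real N)) \<le> \<epsilon>"
proof -
  show N: "1 \<le> N"
    using assms(3) by (simp add: step_bound_def)
  have "2 * qhi * \<Delta> / (\<alpha>1 * \<epsilon>\<^sup>2) \<le> real N"
    using assms(3) by (simp add: step_bound_def)
  then have "2 * qhi * \<Delta> / (\<alpha>1 * real N) \<le> \<epsilon>\<^sup>2"
    using assms(1,2) N by (simp add: field_simps)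
  then show "sqrt (2 * qhi * \<Delta> / (\<alpha>1 * real N)) \<le> \<epsilon>"
    using assms(2) by (intro real_le_lsqrt) auto
qed

lemma step_bound_bigo:
  "(\<lambda>\<epsilon>. real (step_bound qhi \<Delta> \<alpha>1 \<epsilon>)) \<in> O[at_right 0](\<lambda>\<epsilon>. 1 / \<epsilon>\<^sup>2)"
proof -
  define K where "K = \<bar>2 * qhi * \<Delta> / \<alpha>1\<bar>"
  have "\<forall>\<^sub>F \<epsilon> in at_right (0::real). 0 < \<epsilon> \<and> \<epsilon> < 1"
    by (auto simp: eventually_at_right[of "0::real" 1] intro!: exI[of _ 1])
  then have "\<forall>\<^sub>F \<epsilon> in at_right 0.
      norm (real (step_bound qhi \<Delta> \<alpha>1 \<epsilon>)) \<le> (K + 1) * norm (1 / \<epsilon>\<^sup>2)"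
  proof eventually_elim
    case (elim \<epsilon>)
    have "\<epsilon>\<^sup>2 \<le> 1"
      using elim by (simp add: power_le_one)
    then have one_le: "1 \<le> 1 / \<epsilon>\<^sup>2"
      using elim by simp
    have "2 * qhi * \<Delta> / (\<alpha>1 * \<epsilon>\<^sup>2) = 2 * qhi * \<Delta> / \<alpha>1 * (1 / \<epsilon>\<^sup>2)"
      by simp
    also have "\<dots> \<le> K * (1 / \<epsilon>\<^sup>2)"
      unfolding K_def by (intro mult_right_mono abs_ge_self) simp
    finally have "2 * qhi * \<Delta> / (\<alpha>1 * \<epsilon>\<^sup>2) \<le> K * (1 / \<epsilon>\<^sup>2)" .
    moreover have "0 \<le> K * (1 / \<epsilon>\<^sup>2)"
      by (simp add: K_def)
    ultimately have "real (step_bound qhi \<Delta> \<alpha>1 \<epsilon>) \<le> K * (1 / \<epsilon>\<^sup>2) + 1"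
      unfolding step_bound_def by linarith
    also have "\<dots> \<le> (K + 1) * (1 / \<epsilon>\<^sup>2)"
      unfolding distrib_right using one_le by simp
    finally show ?case
      by simp
  qed
  then show ?thesis
    by (rule bigoI)
qed

section \<open>Decrease along a run of the algorithm\<close>

context prox_convex_run
begin

lemma S_initial_segment: "k \<in> S \<Longrightarrow> {..<k} \<subseteq> S"
  using accepted_indices by blast

lemma iterate_in_dom_F: "{..<k} \<subseteq> S \<Longrightarrow> x k \<in> dom_F"
proof (induction k)
  case 0
  then show ?case
    by (simp add: x_init x0_dom)
next
  case (Suc k)
  then have "k \<in> S" and "{..<k} \<subseteq> S"
    by auto
  then show ?case
    using at_acceptance(3)[of k] Suc.IH by (auto simp: accepted_trial_def intro: prox_step_in_dom_F)
qed

lemma telescoped_decrease: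
  assumes nonneg: "\<And>k. k \<in> S \<Longrightarrow> 0 \<le> sqnorm_Q (Q k) (x (Suc k) - x k)"
    and "{..<N} \<subseteq> S"
  shows "ereal (\<alpha>1 / 2 * (\<Sum>k<N. sqnorm_Q (Q k) (x (Suc k) - x k))) \<le> F x0 - F (x N)"
  using assms(2)
proof (induction N)
  case 0
  obtain a where "F x0 = ereal a"
    using x0_dom dom_F_iff by blast
  then show ?case
    by (simp add: x_init)
next
  case (Suc N)
  then have N: "N \<in> S" "{..<N} \<subseteq> S"
    by auto
  obtain a b c where abc: "F x0 = ereal a" "F (x N) = ereal b" "F (x (Suc N)) = ereal c"
    using x0_dom iterate_in_dom_F[OF N(2)] iterate_in_dom_F[OF Suc.prems] dom_F_iff by blast
  have "ereal (\<alpha>1 / 2 * sqnorm_Q (Q N) (x (Suc N) - x N)) \<le> F (x N) - F (x (Suc N))"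
    using params by (intro accepted_trial_decrease[OF _ at_acceptance(3)] iterate_in_dom_F N nonneg)
      auto
  then show ?case
    using Suc.IH[OF N(2)] by (simp add: abc algebra_simps)
qed

end

theorem theorem3p2:
  fixes g :: "real^'m \<Rightarrow> ereal"
    and h :: "real^'d \<Rightarrow> real"
    and C :: "real^'m \<Rightarrow> real^'d"
    and s :: "real^'n \<Rightarrow> real"
    and r :: "'n \<Rightarrow> real^'m \<Rightarrow> real"
    and x0 :: "real^'m"
    and L_h \<beta>_C \<beta>_s L_s :: real
    and L_r \<beta>_r :: "'n \<Rightarrow> real"
    and \<mu>0 \<mu>min \<alpha>1 \<alpha>2 \<nu>inc \<nu>dec eps_term :: real
    and H Q :: "nat \<Rightarrow> real^'m^'m"
    and x G :: "nat \<Rightarrow> real^'m"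
    and \<mu> \<mu>acc :: "nat \<Rightarrow> real"
    and S :: "nat set"
    and qlo qhi \<Delta>F :: real
    and F :: "real^'m \<Rightarrow> ereal"
  assumes run: "prox_convex_run g h C s r x0 L_h \<beta>_C \<beta>_s L_s L_r \<beta>_r
                  \<mu>0 \<mu>min \<alpha>1 \<alpha>2 \<nu>inc \<nu>dec eps_term H x \<mu> \<mu>acc Q S"
    and F_eq: "F = prox_convex_data.F g h C s r"
    and bounded_below: "\<exists>b::real. \<forall>y. ereal b \<le> F y"
    and q_pos: "0 < qlo" "qlo \<le> qhi"
    and metric_bounds: "\<And>k. k \<in> S \<Longrightarrow> mat qlo \<preceq> Q k \<and> Q k \<preceq> mat qhi"
    and G_eq: "\<And>k. G k = Q k *v (x k - x (Suc k))"
    and \<Delta>F_eq: "\<Delta>F = real_of_ereal (F x0 - (INF y. F y))"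
  shows
    "(\<forall>k\<in>S.
        F (x k) - F (x (Suc k)) \<ge> ereal (\<alpha>1 / 2 * sqnorm_Q (Q k) (x (Suc k) - x k)) \<and>
        \<alpha>1 / 2 * sqnorm_Q (Q k) (x (Suc k) - x k) \<ge> \<alpha>1 * qlo / 2 * (norm (x (Suc k) - x k))\<^sup>2) \<and>
     (\<lambda>k. sqnorm_Q (Q k) (x (Suc k) - x k)) summable_on S \<and>
     ((\<lambda>k. norm_Q (Q k) (x (Suc k) - x k)) \<longlongrightarrow> 0) (along S) \<and>
     (\<forall>k\<in>S.
        norm (G k) \<le> qhi * norm (x (Suc k) - x k) \<and>
        qhi * norm (x (Suc k) - x k) \<le> qhi / sqrt qlo * norm_Q (Q k) (x (Suc k) - x k)) \<and>
     ((\<lambda>k. qhi / sqrt qlo * norm_Q (Q k) (x (Suc k) - x k)) \<longlongrightarrow> 0) (along S) \<and>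
     ((\<lambda>k. norm (G k)) \<longlongrightarrow> 0) (along S) \<and>
     (\<forall>N\<ge>1. at_least_accepted N S \<longrightarrow>
        1 / real N * (\<Sum>k\<in>first_accepted N S. (norm (G k))\<^sup>2) \<le> 2 * qhi * \<Delta>F / (\<alpha>1 * real N) \<and>
        Min ((\<lambda>k. norm (G k)) ` first_accepted N S) \<le> sqrt (2 * qhi * \<Delta>F / (\<alpha>1 * real N))) \<and>
     (\<forall>\<epsilon>>0. \<forall>N\<ge>step_bound qhi \<Delta>F \<alpha>1 \<epsilon>. at_least_accepted N S \<longrightarrow>
        Min ((\<lambda>k. norm (G k)) ` first_accepted N S) \<le> \<epsilon>) \<and>
     (\<lambda>\<epsilon>. real (step_bound qhi \<Delta>F \<alpha>1 \<epsilon>)) \<in> O[at_right 0](\<lambda>\<epsilon>. 1 / \<epsilon>\<^sup>2)"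
proof -
  interpret prox_convex_run g h C s r x0 L_h \<beta>_C \<beta>_s L_s L_r \<beta>_r
      \<mu>0 \<mu>min \<alpha>1 \<alpha>2 \<nu>inc \<nu>dec eps_term H x \<mu> \<mu>acc Q S
    by (rule run)
  define q where "q k = sqnorm_Q (Q k) (x (Suc k) - x k)" for k
  let ?d = "\<lambda>k. norm (x (Suc k) - x k)"
  have qhi_pos: "0 < qhi" and \<alpha>1_pos: "0 < \<alpha>1"
    using q_pos params by auto
  have psd_Q: "psd (Q k)" if "k \<in> S" for k
    using psd_of_loewner_ge_mat[of qlo "Q k"] metric_bounds[OF that] q_pos(1) by simp
  have q_lower: "qlo * (?d k)\<^sup>2 \<le> q k" if "k \<in> S" for k
    using loewner_le_sqnorm_Q metric_bounds[OF that] unfolding q_def by (metis sqnorm_Q_mat)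
  have q_upper: "q k \<le> qhi * (?d k)\<^sup>2" if "k \<in> S" for k
    using loewner_le_sqnorm_Q metric_bounds[OF that] unfolding q_def by (metis sqnorm_Q_mat)
  have q_nonneg: "0 \<le> q k" if "k \<in> S" for k
    using psd_Q[OF that] by (simp add: psd_def sqnorm_Q_def q_def)
  have G_sq: "(norm (G k))\<^sup>2 \<le> qhi * q k" if "k \<in> S" for k
    unfolding G_eq q_def sqnorm_Q_minus_commute[of _ "x (Suc k)"]
    using norm_matrix_vector_sq_le_sqnorm_Q[OF psd_Q[OF that]] metric_bounds[OF that] by blast

  \<comment> \<open>\<open>\<Delta>F\<close> is a genuine real number: \<open>F x0\<close> and the infimum of \<open>F\<close> are both finite.\<close>
  obtain b where b: "\<And>y. ereal b \<le> F y"
    using bounded_below by blast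
  obtain a where a: "F x0 = ereal a"
    using x0_dom dom_F_iff unfolding F_eq by blast
  have inf_le: "(INF y. F y) \<le> F y" for y
    by (simp add: INF_lower)
  have "ereal b \<le> (INF y. F y)" and "(INF y. F y) \<le> ereal a"
    using inf_le[of x0] a by (auto intro: INF_greatest b)
  then obtain i where i: "(INF y. F y) = ereal i"
    by (cases "INF y. F y" rule: ereal_cases) fastforce+
  have \<Delta>F: "\<Delta>F = a - i"
    by (simp add: \<Delta>F_eq a i)

  have descent: "F (x k) - F (x (Suc k)) \<ge> ereal (\<alpha>1 / 2 * q k)" if "k \<in> S" for k
    unfolding q_def F_eq using that \<alpha>1_pos q_nonneg[OF that]
    by (intro accepted_trial_decrease[OF iterate_in_dom_F[OF S_initial_segment] at_acceptance(3)])
      (auto simp: q_def)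
  have sum_q: "(\<Sum>k<N. q k) \<le> 2 * \<Delta>F / \<alpha>1" if N: "{..<N} \<subseteq> S" for N
  proof -
    obtain c where c: "F (x N) = ereal c"
      using iterate_in_dom_F[OF N] dom_F_iff unfolding F_eq by blast
    have "ereal (\<alpha>1 / 2 * (\<Sum>k<N. q k)) \<le> F x0 - F (x N)"
      using telescoped_decrease[OF _ N] q_nonneg unfolding q_def F_eq by blast
    moreover have "i \<le> c"
      using inf_le[of "x N"] by (simp add: i c)
    ultimately show ?thesis
      using \<alpha>1_pos by (simp add: a c \<Delta>F field_simps)
  qed

  have summable: "q summable_on S"
  proof (rule nonneg_bdd_above_summable_on)
    show "bdd_above (sum q ` {A. A \<subseteq> S \<and> finite A})"
    proof (rule bdd_aboveI2)
      fix A
      assume "A \<in> {A. A \<subseteq> S \<and> finite A}"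
      then have A: "A \<subseteq> S" "finite A"
        by auto
      \<comment> \<open>The accepted indices form an initial segment of the naturals, so \<open>A\<close> fits into a run of
        consecutive accepted steps.\<close>
      have "\<exists>N. A \<subseteq> {..<N} \<and> {..<N} \<subseteq> S"
      proof (cases "A = {}")
        case False
        then have "Max A \<in> S"
          using Max_in[OF A(2)] A(1) by auto
        then have "{..<Suc (Max A)} \<subseteq> S"
          using S_initial_segment[of "Max A"] by (auto simp: less_Suc_eq)
        moreover have "A \<subseteq> {..<Suc (Max A)}"
          using A(2) by (auto simp: less_Suc_eq_le)
        ultimately show ?thesis
          by blast
      qed (auto intro: exI[of _ 0])
      then obtain N where N: "A \<subseteq> {..<N}" "{..<N} \<subseteq> S"
        by blast
      have "sum q A \<le> (\<Sum>k<N. q k)"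
        using N q_nonneg by (intro sum_mono2) auto
      then show "sum q A \<le> 2 * \<Delta>F / \<alpha>1"
        using sum_q[OF N(2)] by linarith
    qed
  qed (rule q_nonneg)

  have norm_Q_eq: "norm_Q (Q k) (x (Suc k) - x k) = sqrt (q k)" for k
    by (simp add: norm_Q_def q_def)
  have norm_Q_lim: "((\<lambda>k. sqrt (q k)) \<longlongrightarrow> 0) (along S)"
    using tendsto_real_sqrt[OF summable_on_tendsto_along[OF summable]] by simp
  then have scaled_lim: "((\<lambda>k. qhi / sqrt qlo * sqrt (q k)) \<longlongrightarrow> 0) (along S)"
    by (rule tendsto_mult_right_zero)
  have G_le: "norm (G k) \<le> qhi * ?d k" if "k \<in> S" for k
  proof (rule power2_le_imp_le)
    have "(norm (G k))\<^sup>2 \<le> qhi * (qhi * (?d k)\<^sup>2)"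
      using G_sq[OF that] mult_left_mono[OF q_upper[OF that], of qhi] qhi_pos by linarith
    then show "(norm (G k))\<^sup>2 \<le> (qhi * ?d k)\<^sup>2"
      by (simp add: power2_eq_square algebra_simps)
  qed (use qhi_pos in simp)
  have step_le: "qhi * ?d k \<le> qhi / sqrt qlo * sqrt (q k)" if "k \<in> S" for k
  proof -
    have "sqrt qlo * ?d k \<le> sqrt (q k)"
      using real_sqrt_le_mono[OF q_lower[OF that]] by (simp add: real_sqrt_mult)
    then have "?d k \<le> sqrt (q k) / sqrt qlo"
      using q_pos(1) by (simp add: field_simps)
    then show ?thesis
      using mult_left_mono[of _ _ qhi] qhi_pos by fastforce
  qed
  have G_lim: "((\<lambda>k. norm (G k)) \<longlongrightarrow> 0) (along S)"
  proof (rule tendsto_sandwich[OF _ _ tendsto_const scaled_lim])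
    show "\<forall>\<^sub>F k in along S. norm (G k) \<le> qhi / sqrt qlo * sqrt (q k)"
      unfolding along_def eventually_inf_principal
      using order_trans[OF G_le step_le] by (intro always_eventually) blast
  qed simp

  have mean: "1 / real N * (\<Sum>k\<in>first_accepted N S. (norm (G k))\<^sup>2) \<le> 2 * qhi * \<Delta>F / (\<alpha>1 * real N)"
    and min: "Min ((\<lambda>k. norm (G k)) ` first_accepted N S) \<le> sqrt (2 * qhi * \<Delta>F / (\<alpha>1 * real N))"
    if N: "1 \<le> N" "at_least_accepted N S" for N
  proof -
    have first: "{..<N} \<subseteq> S" "first_accepted N S = {..<N}"
      using first_accepted_eq_lessThan S_initial_segment N(2) by blast+
    have "(\<Sum>k<N. (norm (G k))\<^sup>2) \<le> (\<Sum>k<N. qhi * q k)"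
      using first(1) by (intro sum_mono G_sq) auto
    also have "\<dots> \<le> qhi * (2 * \<Delta>F / \<alpha>1)"
      unfolding sum_distrib_left[symmetric]
      using qhi_pos by (intro mult_left_mono sum_q first(1)) auto
    finally show mean: "1 / real N * (\<Sum>k\<in>first_accepted N S. (norm (G k))\<^sup>2)
        \<le> 2 * qhi * \<Delta>F / (\<alpha>1 * real N)"
      unfolding first(2) using N(1) by (simp add: field_simps)
    show "Min ((\<lambda>k. norm (G k)) ` first_accepted N S) \<le> sqrt (2 * qhi * \<Delta>F / (\<alpha>1 * real N))"
      using mean N(1) unfolding first(2) by (intro Min_le_sqrt_mean_square) (auto simp: lessThan_empty_iff)
  qed
  have complexity: "Min ((\<lambda>k. norm (G k)) ` first_accepted N S) \<le> \<epsilon>"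
    if "0 < \<epsilon>" "step_bound qhi \<Delta>F \<alpha>1 \<epsilon> \<le> N" "at_least_accepted N S" for \<epsilon> N
    using min[OF step_bound_sufficient(1)[OF \<alpha>1_pos that(1,2)] that(3)]
      step_bound_sufficient(2)[OF \<alpha>1_pos that(1,2)] by linarith

  have "\<alpha>1 / 2 * q k \<ge> \<alpha>1 * qlo / 2 * (?d k)\<^sup>2" if "k \<in> S" for k
    using mult_left_mono[OF q_lower[OF that], of "\<alpha>1 / 2"] \<alpha>1_pos by simp
  then show ?thesis
    unfolding norm_Q_eq unfolding q_def[symmetric]
    using descent summable norm_Q_lim G_le step_le scaled_lim G_lim mean min complexity
      step_bound_bigo by blast
qed

end
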